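(* Let $q>0$, $q\neq 1$, let $m\geq 1$ be an integer, and let $x,y\in\mathbb{C}$. Then $$\sum_{k=0}^{m}\begin{bmatrix} m\\ k\end{bmatrix}_q q^{-(m-1)(m-k)/2}B_{m-k}(y|q)H_k(x|q)=p_m\bigl(x|y,1/q^{(m-1)/2},q\bigr)=\begin{cases}\displaystyle\prod_{j=1}^{i}v_{2j-1}(x,-y,q) & \text{if } m=2i,\\[2mm] \displaystyle\prod_{j=0}^{i}v_{2j}(x,-y,q) & \text{if } m=2i+1,\end{cases}$$ where $v_0(x,y,q)=x+y$ and, for $n\geq 1$, $$v_n(x,y,q)=x^2+y^2+xy\left(q^{n/2}+q^{-n/2}\right)-\frac{q^n+q^{-n}-2}{q-1}.$$
   Context: Notation: $[0]_q=0$, $[n]_q=1+q+\cdots+q^{n-1}$ for $n\ge1$; $[0]_q!=1$, $[n]_q!=\prod_{i=1}^n[i]_q$; $\begin{bmatrix} n\\k\end{bmatrix}_q=\frac{[n]_q!}{[k]_q!\,[n-k]_q!}$ for $0\le k\le n$. The polynomials are defined by the following recurrences for $n\ge 0$, with $H_{-1}=B_{-1}=p_{-1}=0$ and $H_0=B_0=p_0=1$ (the terms with index $-1$ are zero): $q$-Hermite polynomials: $xH_n(x|q)=H_{n+1}(x|q)+[n]_qH_{n-1}(x|q)$. Polynomials $B_n$: $B_{n+1}(y|q)=-q^{n}yB_n(y|q)+q^{n-1}[n]_qB_{n-1}(y|q)$. Al-Salam-Chihara polynomials: $p_{n+1}(x|y,\rho,q)=(x-\rho yq^n)p_n(x|y,\rho,q)-(1-\rho^2q^{n-1})[n]_q\,p_{n-1}(x|y,\rho,q)$.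 *)

theory Defs
  imports Complex_Main
begin

definition q_bracket :: "'a::field \<Rightarrow> nat \<Rightarrow> 'a" where
  "q_bracket q n = (\<Sum>i<n. q ^ i)"

definition q_fact :: "'a::field \<Rightarrow> nat \<Rightarrow> 'a" where
  "q_fact q n = (\<Prod>i=1..n. q_bracket q i)"

(* Intended for k \<le> n and q_fact q n \<noteq> 0; the latter holds for the image of any positive
   real q.  For k > n the truncated n - k gives a meaningless value. *)
definition q_binomial :: "'a::field \<Rightarrow> nat \<Rightarrow> nat \<Rightarrow> 'a" where
  "q_binomial q n k = q_fact q n / (q_fact q k * q_fact q (n - k))"

(* In the three recurrences below, the case expression implements the convention that the
   polynomial of index -1 is zero.  The exponent n - 1 is an integer, hence powi; at n = 0 it
   only occurs multiplied by zero. *)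

fun q_Hermite :: "'a::field \<Rightarrow> nat \<Rightarrow> 'a \<Rightarrow> 'a" where
  "q_Hermite q 0 x = 1"
| "q_Hermite q (Suc n) x =
     x * q_Hermite q n x
     - q_bracket q n * (case n of 0 \<Rightarrow> 0 | Suc k \<Rightarrow> q_Hermite q k x)"

fun B_poly :: "'a::field \<Rightarrow> nat \<Rightarrow> 'a \<Rightarrow> 'a" where
  "B_poly q 0 y = 1"
| "B_poly q (Suc n) y =
     - (q ^ n) * y * B_poly q n y
     + q powi (int n - 1) * q_bracket q n * (case n of 0 \<Rightarrow> 0 | Suc k \<Rightarrow> B_poly q k y)"

fun Al_Salam_Chihara :: "'a::field \<Rightarrow> 'a \<Rightarrow> nat \<Rightarrow> 'a \<Rightarrow> 'a \<Rightarrow> 'a" where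
  "Al_Salam_Chihara q \<rho> 0 x y = 1"
| "Al_Salam_Chihara q \<rho> (Suc n) x y =
     (x - \<rho> * y * q ^ n) * Al_Salam_Chihara q \<rho> n x y
     - (1 - \<rho>\<^sup>2 * q powi (int n - 1)) * q_bracket q n *
       (case n of 0 \<Rightarrow> 0 | Suc k \<Rightarrow> Al_Salam_Chihara q \<rho> k x y)"

definition v :: "nat \<Rightarrow> complex \<Rightarrow> complex \<Rightarrow> real \<Rightarrow> complex" where
  "v n x y q =
     (if n = 0 then x + y
      else x\<^sup>2 + y\<^sup>2
           + x * y * complex_of_real (q powr (real n / 2) + q powr (- real n / 2))
           - complex_of_real ((q ^ n + q powi (- int n) - 2) / (q - 1)))"

end

theory Submission
  imports Defs
begin

text \<open>The first identity holds for every \<open>\<rho>\<close> and is the factorisation of the generating function of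
  the \<open>p\<^sub>n\<close>. For the product formula, put \<open>\<rho>\<^sub>m = q\<^bsup>-(m-1)/2\<^esup>\<close>. Then \<open>\<rho>\<^sub>m = q \<rho>\<^bsub>m+2\<^esub>\<close>, and replacing
  \<open>\<rho>\<close> by \<open>\<rho> q\<close> changes the generating function by a quadratic factor. This expresses
  \<open>p\<^bsub>m+2\<^esub>(\<rho>\<^bsub>m+2\<^esub>)\<close> through \<open>p\<^bsub>m+2\<^esub>, p\<^bsub>m+1\<^esub>, p\<^sub>m\<close> at \<open>\<rho>\<^sub>m\<close>. Since \<open>1 - \<rho>\<^sub>m\<^sup>2 q\<^bsup>m-1\<^esup> = 0\<close>, all three are multiples of
  \<open>p\<^sub>m(\<rho>\<^sub>m)\<close>, and the resulting quadratic cofactor is \<open>v\<^bsub>m+1\<^esub>(x, -y, q)\<close>.\<close>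

section \<open>Arithmetic of q-brackets and q-factorials\<close>

lemma q_bracket_Suc: "q_bracket q (Suc n) = 1 + q * q_bracket q n"
  unfolding q_bracket_def sum.lessThan_Suc_shift by (simp add: sum_distrib_left)

lemma q_bracket_0 [simp]: "q_bracket q 0 = 0"
  by (simp add: q_bracket_def)

lemma power_eq_q_bracket: "q ^ n = 1 - (1 - q) * q_bracket q n"
  using one_diff_power_eq[of q n] by (simp add: q_bracket_def algebra_simps)

lemma q_bracket_add: "q_bracket q (j + k) = q_bracket q k + q ^ k * q_bracket q j"
  by (induction k) (simp_all add: q_bracket_Suc algebra_simps)

text \<open>Positivity of the real \<open>q\<close> enters here: each bracket is a sum of positive
  terms, whereas at a complex root of unity other than 1 some bracket vanishes.\<close>

lemma q_bracket_of_real_nonzero: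
  assumes "(q::real) > 0" "n > 0"
  shows "q_bracket (of_real q :: 'a::real_field) n \<noteq> 0"
proof -
  have "(\<Sum>i<n. q ^ i) > 0"
    using assms by (intro sum_pos) auto
  moreover have "q_bracket (of_real q :: 'a) n = of_real (\<Sum>i<n. q ^ i)"
    by (simp add: q_bracket_def)
  ultimately show ?thesis
    by (metis less_irrefl of_real_eq_0_iff)
qed

lemma q_fact_0 [simp]: "q_fact q 0 = 1"
  by (simp add: q_fact_def)

lemma q_fact_Suc: "q_fact q (Suc n) = q_bracket q (Suc n) * q_fact q n"
  by (simp add: q_fact_def mult.commute)

lemma q_fact_nonzero:
  assumes "\<And>n. n > 0 \<Longrightarrow> q_bracket q n \<noteq> 0"
  shows "q_fact q n \<noteq> 0"
  using assms by (induction n) (simp_all add: q_fact_Suc)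

section \<open>Three-term recurrences and the convolution formula\<close>

lemma Al_Salam_Chihara_Suc_Suc:
  "Al_Salam_Chihara q \<rho> (Suc (Suc n)) x y =
     (x - \<rho> * y * q ^ Suc n) * Al_Salam_Chihara q \<rho> (Suc n) x y
     - (1 - \<rho>\<^sup>2 * q ^ n) * q_bracket q (Suc n) * Al_Salam_Chihara q \<rho> n x y"
  by simp

lemma B_poly_Suc_Suc:
  "B_poly q (Suc (Suc n)) y =
     - (q ^ Suc n) * y * B_poly q (Suc n) y + q ^ n * q_bracket q (Suc n) * B_poly q n y"
  by simp

lemma q_Hermite_Suc_Suc:
  "q_Hermite q (Suc (Suc n)) x =
     x * q_Hermite q (Suc n) x - q_bracket q (Suc n) * q_Hermite q n x"
  by simp

text \<open>The generating function of the normalised polynomials \<open>p\<^sub>n / [n]!\<close> is the product of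
  those of \<open>\<rho>\<^sup>j B\<^sub>j / [j]!\<close> and \<open>H\<^sub>k / [k]!\<close>. On coefficients, writing
  \<open>[j + k] = [k] + q\<^sup>k [j]\<close> in the convolution lets each factor use its own recurrence.\<close>

lemma Al_Salam_Chihara_eq_convolution:
  fixes q \<rho> x y :: "'a::field"
  assumes nz: "\<And>n. n > 0 \<Longrightarrow> q_bracket q n \<noteq> 0"
  shows "Al_Salam_Chihara q \<rho> n x y =
    (\<Sum>k\<le>n. q_binomial q n k * \<rho> ^ (n - k) * B_poly q (n - k) y * q_Hermite q k x)"
proof -
  define h where "h k = q_Hermite q k x / q_fact q k" for k
  define b where "b j = \<rho> ^ j * B_poly q j y / q_fact q j" for j
  define c where "c n = (\<Sum>k\<le>n. b (n - k) * h k)" for n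
  note fnz = q_fact_nonzero[OF nz]
  have h0: "h 0 = 1" "q_bracket q (Suc 0) * h (Suc 0) = x * h 0"
    using nz[of 1] by (simp_all add: h_def q_fact_Suc)
  have hS: "q_bracket q (Suc (Suc k)) * h (Suc (Suc k)) = x * h (Suc k) - h k" for k
    using fnz[of k] nz[of "Suc k"] nz[of "Suc (Suc k)"]
    by (simp add: h_def q_fact_Suc q_Hermite_Suc_Suc field_simps
        del: q_Hermite.simps)
  have b0: "b 0 = 1" "q_bracket q (Suc 0) * b (Suc 0) = - \<rho> * y * b 0"
    using nz[of 1] by (simp_all add: b_def q_fact_Suc)
  have bS: "q_bracket q (Suc (Suc j)) * b (Suc (Suc j)) =
      - (q ^ Suc j) * \<rho> * y * b (Suc j) + q ^ j * \<rho>\<^sup>2 * b j" for j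
    using fnz[of j] nz[of "Suc j"] nz[of "Suc (Suc j)"]
    by (simp add: b_def q_fact_Suc B_poly_Suc_Suc field_simps power2_eq_square
        del: B_poly.simps)
  have split: "q_bracket q (Suc n) * c (Suc n) =
      (\<Sum>k\<le>n. b (n - k) * (q_bracket q (Suc k) * h (Suc k)))
      + (\<Sum>k\<le>n. q ^ k * (q_bracket q (Suc (n - k)) * b (Suc (n - k))) * h k)" for n
  proof -
    have "q_bracket q (Suc n) * c (Suc n) =
        (\<Sum>k\<le>Suc n. b (Suc n - k) * (q_bracket q k * h k)
          + q ^ k * (q_bracket q (Suc n - k) * b (Suc n - k)) * h k)"
      unfolding c_def sum_distrib_left
    proof (rule sum.cong[OF refl])
      fix k assume "k \<in> {..Suc n}"
      then have "q_bracket q (Suc n) = q_bracket q k + q ^ k * q_bracket q (Suc n - k)"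
        using q_bracket_add[of q "Suc n - k" k] by simp
      then show "q_bracket q (Suc n) * (b (Suc n - k) * h k) =
          b (Suc n - k) * (q_bracket q k * h k)
          + q ^ k * (q_bracket q (Suc n - k) * b (Suc n - k)) * h k"
        by (simp add: algebra_simps)
    qed
    also have "\<dots> = (\<Sum>k\<le>Suc n. b (Suc n - k) * (q_bracket q k * h k))
        + (\<Sum>k\<le>Suc n. q ^ k * (q_bracket q (Suc n - k) * b (Suc n - k)) * h k)"
      by (rule sum.distrib)
    \<comment> \<open>Since [0] = 0, the first sum loses its term k = 0 and the second its term k =
      n + 1.\<close>
    also have "(\<Sum>k\<le>Suc n. b (Suc n - k) * (q_bracket q k * h k)) =
        (\<Sum>k\<le>n. b (n - k) * (q_bracket q (Suc k) * h (Suc k)))"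
      by (subst sum.atMost_Suc_shift) simp
    also have "(\<Sum>k\<le>Suc n. q ^ k * (q_bracket q (Suc n - k) * b (Suc n - k)) * h k) =
        (\<Sum>k\<le>n. q ^ k * (q_bracket q (Suc (n - k)) * b (Suc (n - k))) * h k)"
      by (simp add: Suc_diff_le)
    finally show ?thesis .
  qed
  have c_rec: "q_bracket q (Suc (Suc n)) * c (Suc (Suc n)) =
      (x - \<rho> * y * q ^ Suc n) * c (Suc n) - (1 - \<rho>\<^sup>2 * q ^ n) * c n" for n
  proof -
    \<comment> \<open>The recurrence \<open>hS\<close> starts at index 2, so the term k = 0 is split
      off and handled by \<open>h0\<close>.\<close>
    have "(\<Sum>k\<le>Suc n. b (Suc n - k) * (q_bracket q (Suc k) * h (Suc k))) =
        b (Suc n) * (x * h 0) + (\<Sum>k\<le>n. b (n - k) * (x * h (Suc k) - h k))"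
      by (subst sum.atMost_Suc_shift) (simp add: hS h0)
    also have "\<dots> = x * (b (Suc n) * h 0 + (\<Sum>k\<le>n. b (n - k) * h (Suc k))) - c n"
      by (simp add: c_def sum_subtractf sum_distrib_left algebra_simps)
    also have "b (Suc n) * h 0 + (\<Sum>k\<le>n. b (n - k) * h (Suc k)) = c (Suc n)"
      unfolding c_def by (subst sum.atMost_Suc_shift) simp
    finally have 1: "(\<Sum>k\<le>Suc n. b (Suc n - k) * (q_bracket q (Suc k) * h (Suc k))) =
      x * c (Suc n) - c n" .
    \<comment> \<open>Here the term k = n + 1 is split off and handled by \<open>b0\<close>. In the
      others q^k q^(n-k) = q^n makes the coefficients independent of k, so the sums become values of
      \<open>c\<close> again.\<close>
    have "(\<Sum>k\<le>Suc n. q ^ k * (q_bracket q (Suc (Suc n - k)) * b (Suc (Suc n - k))) * h k) =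
        (\<Sum>k\<le>n. q ^ k * (- (q ^ Suc (n - k)) * \<rho> * y * b (Suc (n - k))
            + q ^ (n - k) * \<rho>\<^sup>2 * b (n - k)) * h k)
        - \<rho> * y * q ^ Suc n * (b 0 * h (Suc n))"
      by (simp add: Suc_diff_le bS b0)
    also have "(\<Sum>k\<le>n. q ^ k * (- (q ^ Suc (n - k)) * \<rho> * y * b (Suc (n - k))
            + q ^ (n - k) * \<rho>\<^sup>2 * b (n - k)) * h k) =
        (\<Sum>k\<le>n. - (\<rho> * y * q ^ Suc n) * (b (Suc n - k) * h k)
            + \<rho>\<^sup>2 * q ^ n * (b (n - k) * h k))"
    proof (rule sum.cong[OF refl])
      fix k assume "k \<in> {..n}"
      then have "q ^ n = q ^ k * q ^ (n - k)" "Suc n - k = Suc (n - k)"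
        by (auto simp flip: power_add)
      then show "q ^ k * (- (q ^ Suc (n - k)) * \<rho> * y * b (Suc (n - k))
            + q ^ (n - k) * \<rho>\<^sup>2 * b (n - k)) * h k =
          - (\<rho> * y * q ^ Suc n) * (b (Suc n - k) * h k) + \<rho>\<^sup>2 * q ^ n * (b (n - k) * h k)"
        by (simp add: algebra_simps)
    qed
    also have "\<dots> - \<rho> * y * q ^ Suc n * (b 0 * h (Suc n)) =
        - \<rho> * y * q ^ Suc n * c (Suc n) + \<rho>\<^sup>2 * q ^ n * c n"
      unfolding c_def sum.distrib sum_distrib_left[symmetric] by (simp add: algebra_simps)
    finally have 2: "(\<Sum>k\<le>Suc n. q ^ k * (q_bracket q (Suc (Suc n - k))
        * b (Suc (Suc n - k))) * h k) =
      - \<rho> * y * q ^ Suc n * c (Suc n) + \<rho>\<^sup>2 * q ^ n * c n" .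
    show ?thesis
      unfolding split[of "Suc n"] 1 2 by (simp add: algebra_simps)
  qed
  \<comment> \<open>Multiplying \<open>c_rec\<close> by [n+1]! gives exactly the recurrence of p_n,
    so two initial values suffice.\<close>
  have "Al_Salam_Chihara q \<rho> n x y = q_fact q n * c n"
  proof (induction n rule: induct_nat_012)
    case 0
    show ?case by (simp add: c_def h0 b0)
  next
    case 1
    have "q_bracket q (Suc 0) = 1" by (simp add: q_bracket_Suc)
    then show ?case using h0 b0
      by (simp add: c_def q_fact_Suc)
  next
    case (ge2 n)
    have "q_fact q (Suc (Suc n)) * c (Suc (Suc n)) =
        q_fact q (Suc n) * (q_bracket q (Suc (Suc n)) * c (Suc (Suc n)))"
      by (simp add: q_fact_Suc)
    also have "\<dots> = (x - \<rho> * y * q ^ Suc n) * (q_fact q (Suc n) * c (Suc n))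
        - (1 - \<rho>\<^sup>2 * q ^ n) * q_bracket q (Suc n) * (q_fact q n * c n)"
      unfolding c_rec by (simp add: q_fact_Suc algebra_simps)
    finally show ?case
      unfolding Al_Salam_Chihara_Suc_Suc ge2 by simp
  qed
  also have "\<dots> = (\<Sum>k\<le>n. q_binomial q n k * \<rho> ^ (n - k) * B_poly q (n - k) y * q_Hermite q k x)"
    unfolding c_def sum_distrib_left
    by (intro sum.cong) (simp_all add: b_def h_def q_binomial_def field_simps)
  finally show ?thesis .
qed

section \<open>The shift of \<rho> by q and the resulting factorisation\<close>

text \<open>The quadratic factor is \<open>1 - (1 - q) \<rho> y t + (1 - q) \<rho>\<^sup>2 t\<^sup>2\<close> in
  \<open>\<Sum>n. p\<^sub>n t\<^sup>n / [n]!\<close>.\<close>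

lemma Al_Salam_Chihara_shift:
  "Al_Salam_Chihara q \<rho> (Suc (Suc n)) x y =
     Al_Salam_Chihara q (\<rho> * q) (Suc (Suc n)) x y
     - (1 - q) * \<rho> * y * q_bracket q (Suc (Suc n)) * Al_Salam_Chihara q (\<rho> * q) (Suc n) x y
     + (1 - q) * \<rho>\<^sup>2 * q_bracket q (Suc (Suc n)) * q_bracket q (Suc n)
         * Al_Salam_Chihara q (\<rho> * q) n x y"
proof (induction n rule: induct_nat_012)
  case 0
  show ?case
    by (simp add: q_bracket_Suc) algebra
next
  case 1
  show ?case
    by (simp add: q_bracket_Suc) algebra
next
  case (ge2 n)
  define T where "T = q ^ Suc (Suc n)"
  define L where "L = q_bracket q (Suc (Suc n))"
  define M where "M = q_bracket q (Suc n)"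
  define p where "p k = Al_Salam_Chihara q (\<rho> * q) (n + k) x y" for k
  have brackets: "q_bracket q (Suc n) = M"
    "q_bracket q (Suc (Suc n)) = L"
    "q_bracket q (Suc (Suc (Suc n))) = L + T"
    "q_bracket q (Suc (Suc (Suc (Suc n)))) = L + T + q * T"
    by (simp_all add: q_bracket_def L_def M_def T_def)
  have powers: "q ^ Suc (Suc n) = T" "q ^ Suc (Suc (Suc n)) = q * T"
    by (simp_all add: T_def)
  have p: "Al_Salam_Chihara q (\<rho> * q) n x y = p 0"
    "Al_Salam_Chihara q (\<rho> * q) (Suc n) x y = p 1"
    "Al_Salam_Chihara q (\<rho> * q) (Suc (Suc n)) x y = p 2"
    "Al_Salam_Chihara q (\<rho> * q) (Suc (Suc (Suc n))) x y = p 3"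
    "Al_Salam_Chihara q (\<rho> * q) (Suc (Suc (Suc (Suc n)))) x y = p 4"
    by (simp_all add: p_def numeral_eq_Suc)
  \<comment> \<open>Solved for \<open>x * p k\<close>: once the induction hypotheses replace p_(n+2)
    and p_(n+3) at \<rho>, \<open>x\<close> occurs only in such products. Eliminating them leaves an
    identity linear in \<open>p 0\<close>, ..., \<open>p 4\<close>.\<close>
  have rec: "x * p 1 = p 2 + \<rho> * y * T * p 1 + (1 - \<rho>\<^sup>2 * T) * M * p 0"
    "x * p 2 = p 3 + \<rho> * y * (q * T) * p 2 + (1 - \<rho>\<^sup>2 * (q * T)) * L * p 1"
    "x * p 3 = p 4 + \<rho> * y * (q * (q * T)) * p 3 + (1 - \<rho>\<^sup>2 * (q * (q * T))) * (L + T) * p 2"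
    using Al_Salam_Chihara_Suc_Suc[of q "\<rho> * q" n x y]
      Al_Salam_Chihara_Suc_Suc[of q "\<rho> * q" "Suc n" x y]
      Al_Salam_Chihara_Suc_Suc[of q "\<rho> * q" "Suc (Suc n)" x y]
    unfolding p brackets T_def by (simp_all add: algebra_simps power2_eq_square)
  have expand: "(x - s) * (p 3 - a * p 2 + b * p 1) =
      x * p 3 - s * p 3 - a * (x * p 2 - s * p 2) + b * (x * p 1 - s * p 1)" for s a b
    by (simp add: algebra_simps)
  show ?case
    unfolding Al_Salam_Chihara_Suc_Suc[of q \<rho> "Suc (Suc n)"] ge2 p brackets powers expand rec
    by (simp add: algebra_simps power2_eq_square)
qed

text \<open>Here \<sigma> stands for rho_(m+2) and \<sigma> q for rho_m. The hypothesis says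
  (\<sigma> q)^2 q^(m-1) = 1, which removes the lower term from the recurrence for p_(m+1) at
  \<sigma> q.\<close>

lemma Al_Salam_Chihara_factor:
  assumes "\<sigma>\<^sup>2 * q ^ Suc m = 1"
  shows "Al_Salam_Chihara q \<sigma> (Suc (Suc m)) x y =
    (x\<^sup>2 + y\<^sup>2 - x * y * (\<sigma> * q ^ Suc m + \<sigma>) - q_bracket q (Suc m) * (1 - \<sigma>\<^sup>2))
      * Al_Salam_Chihara q (\<sigma> * q) m x y"
proof -
  define M where "M = q_bracket q (Suc m)"
  define T where "T = q ^ Suc m"
  define P where "P = Al_Salam_Chihara q (\<sigma> * q) m x y"
  have T: "T = 1 - (1 - q) * M" "\<sigma>\<^sup>2 * T = 1"
    using assms by (simp_all only: T_def M_def power_eq_q_bracket[of q "Suc m"])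
  have M: "q_bracket q (Suc (Suc m)) = 1 + q * M"
    by (simp only: M_def q_bracket_Suc[of q "Suc m"])
  have pow: "q * q ^ m = T" "q ^ Suc m = T"
    by (simp_all add: T_def)
  \<comment> \<open>For m = 0 there is no lower term anyway; otherwise its coefficient
    vanishes.\<close>
  have 1: "Al_Salam_Chihara q (\<sigma> * q) (Suc m) x y = (x - \<sigma> * y * T) * P"
  proof (cases m)
    case 0
    then show ?thesis by (simp add: P_def T_def)
  next
    case (Suc n)
    have "1 - (\<sigma> * q)\<^sup>2 * q ^ n = 0"
      using assms by (simp add: Suc power2_eq_square mult_ac)
    then show ?thesis
      unfolding Suc Al_Salam_Chihara_Suc_Suc P_def T_def by (simp add: mult_ac)
  qed
  have 2: "Al_Salam_Chihara q (\<sigma> * q) (Suc (Suc m)) x y =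
      (x - \<sigma> * q * y * T) * ((x - \<sigma> * y * T) * P) - (1 - \<sigma>\<^sup>2 * q * T) * M * P"
    unfolding Al_Salam_Chihara_Suc_Suc 1 P_def[symmetric] M_def[symmetric] pow
    by (simp add: power2_eq_square mult_ac flip: pow(1))
  show ?thesis
    \<comment> \<open>The relations \<open>T\<close> collapse the cofactor: for instance the y^2
      coefficients q T and (1 - q)(1 + q M) = 1 - q T add up to 1.\<close>
    unfolding Al_Salam_Chihara_shift[of q \<sigma> m] 1 2 M P_def[symmetric] M_def[symmetric] pow
    using T by algebra
qed

section \<open>The critical parameter for real q and the product formula\<close>

text \<open>For q > 0 this is the positive root of rho^2 q^(m-1) = 1. The subtraction is real, so m
  = 0 gives q^(1/2) and the even case can start there.\<close>

definition critical_rho :: "real \<Rightarrow> nat \<Rightarrow> complex" where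
  "critical_rho q m = complex_of_real (1 / q powr ((real m - 1) / 2))"

lemma Al_Salam_Chihara_critical_step:
  fixes q :: real
  assumes q: "q > 0" "q \<noteq> 1"
  shows "Al_Salam_Chihara (complex_of_real q) (critical_rho q (Suc (Suc m))) (Suc (Suc m)) x y =
    v (Suc m) x (- y) q * Al_Salam_Chihara (complex_of_real q) (critical_rho q m) m x y"
proof -
  define s where "s = q powr (- real (Suc m) / 2)"
  have "(real (Suc (Suc m)) - 1) / 2 = real (Suc m) / 2"
    by simp
  then have rho: "critical_rho q (Suc (Suc m)) = of_real s"
    by (simp only: critical_rho_def s_def powr_minus_divide minus_divide_left[symmetric])
  have "q powr (- real (Suc m) / 2) * q = q powr (- real (Suc m) / 2 + 1)"
    using q by (simp only: powr_add) simp
  also have "- real (Suc m) / 2 + 1 = - ((real m - 1) / 2)"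
    by (simp add: field_simps)
  finally have rho': "critical_rho q m = of_real s * of_real q"
    by (simp only: critical_rho_def s_def powr_minus_divide of_real_mult[symmetric])
  have sq: "s\<^sup>2 = q powi (- int (Suc m))"
  proof -
    have "s\<^sup>2 = q powr (- real (Suc m))"
      unfolding s_def power2_eq_square powr_add[symmetric] by simp
    then show ?thesis
      using q by (metis powr_real_of_int' less_imp_le of_int_minus of_int_of_nat_eq less_numeral_extra(3))
  qed
  then have one: "s\<^sup>2 * q ^ Suc m = 1"
    using q by (simp add: power_int_minus del: of_nat_Suc power_Suc)
  \<comment> \<open>Together with \<open>s\<close> this yields the two half-integer powers in the xy
    term of \<open>v\<close>.\<close>
  have half: "s * q ^ Suc m = q powr (real (Suc m) / 2)"
    using q unfolding s_def
    by (subst powr_realpow[symmetric], simp, subst powr_add[symmetric]) (simp add: field_simps)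
  \<comment> \<open>Here q \<noteq> 1 gives the closed form of the bracket, and s^2 q^(m+1) = 1
    produces the constant -2.\<close>
  have const: "q_bracket (complex_of_real q) (Suc m) * (1 - (of_real s)\<^sup>2) =
      of_real ((q ^ Suc m + q powi (- int (Suc m)) - 2) / (q - 1))"
  proof -
    have "q_bracket q (Suc m) = (q ^ Suc m - 1) / (q - 1)"
      using power_eq_q_bracket[of q "Suc m"] q by (simp add: field_simps)
    moreover have "(q ^ Suc m - 1) * (1 - s\<^sup>2) = q ^ Suc m + s\<^sup>2 - 2"
      using one by (simp add: algebra_simps)
    ultimately have "q_bracket q (Suc m) * (1 - s\<^sup>2) = (q ^ Suc m + s\<^sup>2 - 2) / (q - 1)"
      by (simp only: times_divide_eq_left)
    moreover have "q_bracket (complex_of_real q) (Suc m) * (1 - (of_real s)\<^sup>2) =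
        of_real (q_bracket q (Suc m) * (1 - s\<^sup>2))"
      by (simp add: q_bracket_def)
    ultimately have "q_bracket (complex_of_real q) (Suc m) * (1 - (of_real s)\<^sup>2) =
        of_real ((q ^ Suc m + s\<^sup>2 - 2) / (q - 1))"
      by (simp only:)
    then show ?thesis unfolding sq .
  qed
  have "(complex_of_real s)\<^sup>2 * of_real q ^ Suc m = 1"
    using one by (metis of_real_1 of_real_mult of_real_power)
  from Al_Salam_Chihara_factor[OF this, of x y]
  have "Al_Salam_Chihara (complex_of_real q) (of_real s) (Suc (Suc m)) x y =
    (x\<^sup>2 + y\<^sup>2 - x * y * of_real (s * q ^ Suc m + s)
       - of_real ((q ^ Suc m + q powi (- int (Suc m)) - 2) / (q - 1)))
      * Al_Salam_Chihara (complex_of_real q) (of_real s * of_real q) m x y"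
    unfolding const by simp
  then show ?thesis
    unfolding rho rho' half v_def by (simp add: s_def)
qed

lemma Al_Salam_Chihara_critical_even:
  assumes "q > 0" "q \<noteq> 1"
  shows "Al_Salam_Chihara (complex_of_real q) (critical_rho q (2 * i)) (2 * i) x y =
    (\<Prod>j=1..i. v (2 * j - 1) x (- y) q)"
proof (induction i)
  case (Suc i)
  then show ?case
    using Al_Salam_Chihara_critical_step[OF assms, of "2 * i" x y] by (simp add: mult.commute)
qed simp

lemma Al_Salam_Chihara_critical_odd:
  assumes "q > 0" "q \<noteq> 1"
  shows "Al_Salam_Chihara (complex_of_real q) (critical_rho q (2 * i + 1)) (2 * i + 1) x y =
    (\<Prod>j=0..i. v (2 * j) x (- y) q)"
proof (induction i)
  case 0
  \<comment> \<open>At m = 1 the critical value is 1, so p_1 = x - y, which is v_0(x, -y).\<close>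
  then show ?case using assms by (simp add: critical_rho_def v_def)
next
  case (Suc i)
  then show ?case
    using Al_Salam_Chihara_critical_step[OF assms, of "2 * i + 1" x y] by (simp add: mult.commute)
qed

theorem corollary1:
  fixes q :: real and m :: nat and x y :: complex
  assumes "q > 0" and "q \<noteq> 1" and "m \<ge> 1"
  shows "(\<Sum>k=0..m. q_binomial (complex_of_real q) m k
              * complex_of_real (q powr (- ((real m - 1) * (real m - real k) / 2)))
              * B_poly (complex_of_real q) (m - k) y
              * q_Hermite (complex_of_real q) k x)
           = Al_Salam_Chihara (complex_of_real q)
               (complex_of_real (1 / q powr ((real m - 1) / 2))) m x y
       \<and> (\<forall>i. m = 2 * i \<longrightarrow>
            Al_Salam_Chihara (complex_of_real q)
              (complex_of_real (1 / q powr ((real m - 1) / 2))) m x y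
            = (\<Prod>j=1..i. v (2 * j - 1) x (- y) q))
       \<and> (\<forall>i. m = 2 * i + 1 \<longrightarrow>
            Al_Salam_Chihara (complex_of_real q)
              (complex_of_real (1 / q powr ((real m - 1) / 2))) m x y
            = (\<Prod>j=0..i. v (2 * j) x (- y) q))"
proof -
  have pow: "complex_of_real (q powr (- ((real m - 1) * (real m - real k) / 2))) =
      critical_rho q m ^ (m - k)" if "k \<le> m" for k
  proof -
    have "(q powr (- ((real m - 1) / 2))) ^ (m - k) =
        q powr (- ((real m - 1) * (real m - real k) / 2))"
      using assms(1) that
      by (simp add: powr_realpow[symmetric] powr_powr of_nat_diff)
    then show ?thesis
      unfolding critical_rho_def powr_minus_divide[symmetric] by (metis of_real_power)
  qed
  have "q_bracket (complex_of_real q) n \<noteq> 0" if "n > 0" for n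
    using q_bracket_of_real_nonzero assms(1) that by blast
  from Al_Salam_Chihara_eq_convolution[OF this]
  have sum: "(\<Sum>k=0..m. q_binomial (complex_of_real q) m k
              * complex_of_real (q powr (- ((real m - 1) * (real m - real k) / 2)))
              * B_poly (complex_of_real q) (m - k) y
              * q_Hermite (complex_of_real q) k x) =
      Al_Salam_Chihara (complex_of_real q) (critical_rho q m) m x y"
    by (simp add: pow atMost_atLeast0)
  show ?thesis
    unfolding critical_rho_def[symmetric] sum
    using Al_Salam_Chihara_critical_even[OF assms(1,2)]
      Al_Salam_Chihara_critical_odd[OF assms(1,2)] by blast
qed

end
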